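(* Let $k\ge 3$ and let $\widetilde{\Gamma}_0(2)\subseteq \mathrm{AGL}_2(\mathbb{Z}/2^k\mathbb{Z})$ be the subgroup of all $(\vec v,g)$ with $\vec v\in(\mathbb{Z}/2^k\mathbb{Z})^2$ arbitrary and $g=\begin{bmatrix} a&b\\ c&d\end{bmatrix}\in\mathrm{GL}_2(\mathbb{Z}/2^k\mathbb{Z})$ with $c\equiv 0\pmod 2$. If $H\subseteq\widetilde{\Gamma}_0(2)$ is a subgroup containing $\{(\vec v,g):\vec v\equiv 0\pmod 8,\ g\equiv I\pmod 8\}$, then the Frattini subgroup $\Phi(H)$ contains $\{(\vec v,g):\vec v\equiv 0\pmod{16},\ g\equiv I\pmod{16}\}$.
   Context: $\mathrm{AGL}_2(\mathbb{Z}/2^k\mathbb{Z})$ is the set of pairs $(\vec v,g)$ with $\vec v\in(\mathbb{Z}/2^k\mathbb{Z})^2$ a row vector and $g\in\mathrm{GL}_2(\mathbb{Z}/2^k\mathbb{Z})$, with product $(\vec v_1,g_1)*(\vec v_2,g_2)=(\vec v_2+\vec v_1g_1,g_1g_2)$. The Frattini subgroup $\Phi(H)$ of a finite group $H$ is the intersection of all maximal subgroups of $H$.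
   Formalization: The product on AGL_2 is taken as (v1,g1)*(v2,g2) = (v2 + v1 g2, g1 g2), because the stated formula (v2 + v1 g1, g1 g2) is not associative and does not define a group. *)

theory Defs
  imports
    "HOL-Analysis.Cartesian_Space"
    "HOL-Algebra.Coset"
    "Berlekamp_Zassenhaus.Finite_Field"
begin

type_synonym 'a affine2 = "('a^2) \<times> ('a^2^2)"

text \<open>
  The product is that of the affine maps \<open>x \<mapsto> x g + v\<close> on row vectors, composed from left to
  right. The formula \<open>(v\<^sub>2 + v\<^sub>1 g\<^sub>1, g\<^sub>1 g\<^sub>2)\<close> found in the source is not associative;
  the matrix acting on \<open>v\<^sub>1\<close> has to be \<open>g\<^sub>2\<close>.
\<close>

definition AGL2 :: "'a::comm_ring_1 affine2 monoid" where
  "AGL2 = \<lparr>carrier = {(v, g). invertible g},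
           monoid.mult = (\<lambda>(v1, g1) (v2, g2). (v2 + v1 v* g2, g1 ** g2)),
           one = (0, mat 1)\<rparr>"

definition Gamma0_2_tilde :: "'a::comm_ring_1 affine2 set" where
  "Gamma0_2_tilde = {(v, g). (v, g) \<in> carrier AGL2 \<and> 2 dvd g $ 2 $ 1}"

text \<open>
  In \<open>\<int>/2\<^sup>k\<close> a congruence modulo \<open>m\<close> is a congruence modulo the ideal generated by \<open>m\<close>;
  so it is equality if \<open>2\<^sup>k\<close> divides \<open>m\<close>, as for \<open>m = 16\<close> and \<open>k = 3\<close>.
\<close>

definition congruence_kernel :: "nat \<Rightarrow> 'a::comm_ring_1 affine2 set" where
  "congruence_kernel m =
     {(v, g). (v, g) \<in> carrier AGL2 \<and>
        (\<forall>i. of_nat m dvd v $ i) \<and> (\<forall>i j. of_nat m dvd (g - mat 1) $ i $ j)}"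

definition maximal_subgroup :: "'g set \<Rightarrow> ('g, 'b) monoid_scheme \<Rightarrow> bool" where
  "maximal_subgroup M G \<longleftrightarrow>
     subgroup M G \<and> M \<noteq> carrier G \<and>
     (\<forall>K. subgroup K G \<longrightarrow> M \<subseteq> K \<longrightarrow> K = M \<or> K = carrier G)"

text \<open>
  Intersecting with the carrier only matters for a group without maximal subgroups, such as
  the trivial group, whose Frattini subgroup is then the whole group.
\<close>

definition frattini :: "('g, 'b) monoid_scheme \<Rightarrow> 'g set" where
  "frattini G = carrier G \<inter> \<Inter> {M. maximal_subgroup M G}"

lemma invertible_mat_1: "invertible (mat 1 :: 'a::semiring_1^'n^'n)"
  unfolding invertible_def by (rule exI[of _ "mat 1"]) simp

lemma group_AGL2: "group (AGL2 :: 'a::comm_ring_1 affine2 monoid)"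
proof (rule groupI)
  fix x assume "x \<in> carrier (AGL2 :: 'a affine2 monoid)"
  then obtain v g where x: "x = (v, g)" and "invertible g"
    by (auto simp: AGL2_def)
  then obtain h where h: "g ** h = mat 1" "h ** g = mat 1"
    by (auto simp: invertible_def)
  have neg: "(- (v v* h)) v* g = - ((v v* h) v* g)"
    by (simp add: vector_matrix_mult_def vec_eq_iff sum_negf)
  have "(- (v v* h), h) \<in> carrier AGL2"
    using h by (auto simp: AGL2_def invertible_def)
  moreover have "(- (v v* h), h) \<otimes>\<^bsub>AGL2\<^esub> x = \<one>\<^bsub>AGL2\<^esub>"
    by (simp add: AGL2_def x h neg vector_matrix_mul_assoc)
  ultimately show "\<exists>y\<in>carrier AGL2. y \<otimes>\<^bsub>AGL2\<^esub> x = \<one>\<^bsub>AGL2\<^esub>" by blast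
qed (auto simp: AGL2_def invertible_mult invertible_mat_1 matrix_mul_assoc
      vector_matrix_mul_assoc vector_matrix_left_distrib algebra_simps)

lemma subgroup_Gamma0_2_tilde: "subgroup Gamma0_2_tilde AGL2"
proof (rule group.subgroupI[OF group_AGL2])
  show "Gamma0_2_tilde \<subseteq> carrier AGL2" by (auto simp: Gamma0_2_tilde_def)
  have "(0, mat 1) \<in> Gamma0_2_tilde"
    by (simp add: Gamma0_2_tilde_def AGL2_def invertible_mat_1) (simp add: mat_def)
  then show "Gamma0_2_tilde \<noteq> {}" by blast
next
  fix x y :: "'a affine2"
  assume "x \<in> Gamma0_2_tilde" "y \<in> Gamma0_2_tilde"
  then show "x \<otimes>\<^bsub>AGL2\<^esub> y \<in> Gamma0_2_tilde"
    by (auto simp: Gamma0_2_tilde_def AGL2_def invertible_mult)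
      (simp add: matrix_matrix_mult_def sum_2)
next
  fix x :: "'a affine2"
  assume x: "x \<in> Gamma0_2_tilde"
  interpret group "AGL2 :: 'a affine2 monoid" by (rule group_AGL2)
  have xc: "x \<in> carrier AGL2" using x by (auto simp: Gamma0_2_tilde_def)
  obtain v g where xg: "x = (v, g)" by (cases x)
  obtain w h where yh: "inv\<^bsub>AGL2\<^esub> x = (w, h)" by (cases "inv\<^bsub>AGL2\<^esub> x")
  have gh: "g ** h = mat 1"
    using r_inv[OF xc] unfolding yh unfolding xg by (simp add: AGL2_def)
  have c: "2 dvd g $ 2 $ 1" using x by (auto simp: Gamma0_2_tilde_def xg)
  have "(g ** h) $ 2 $ 1 = 0" "(g ** h) $ 2 $ 2 = 1"
    by (simp_all add: gh mat_def)
  then have e1: "g$2$1 * h$1$1 + g$2$2 * h$2$1 = 0"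
    and e2: "g$2$1 * h$1$2 + g$2$2 * h$2$2 = 1"
    by (simp_all add: matrix_matrix_mult_def sum_2)
  have "h$2$1 = h$2$1 * (g$2$1 * h$1$2 + g$2$2 * h$2$2)" by (simp add: e2)
  also have "\<dots> = g$2$1 * (h$2$1 * h$1$2) + (g$2$2 * h$2$1) * h$2$2"
    by (simp add: algebra_simps)
  also have "g$2$2 * h$2$1 = g$2$1 * (- (h$1$1))"
    using e1 by (simp add: add_eq_0_iff)
  finally have "2 dvd h $ 2 $ 1"
    using c by (metis dvd_add dvd_mult2)
  then show "inv\<^bsub>AGL2\<^esub> x \<in> Gamma0_2_tilde"
    using inv_closed[OF xc] by (simp add: Gamma0_2_tilde_def yh)
qed

end

theory Submission
  imports Defs
begin

text \<open>
  Write \<open>(v, g)\<close> as the \<open>3 \<times> 2\<close> array with rows \<open>v\<close> and the rows of \<open>g - 1\<close>. Weighting the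
  columns by the Iwahori filtration of the upper triangular order at 2 gives a descending chain
  \<open>L\<^sub>0 \<supseteq> L\<^sub>1 \<supseteq> \<dots>\<close> that starts with \<open>\<Gamma>\<^sub>0(2)~\<close>, ends with the trivial group, and satisfies
  \<open>[L\<^sub>n, \<Gamma>\<^sub>0(2)~] \<subseteq> L\<^sub>n\<^sub>+\<^sub>1\<close> and \<open>y\<^sup>2 \<in> L\<^sub>n\<^sub>+\<^sub>1\<close> for \<open>y \<in> L\<^sub>n\<close>. If \<open>M\<close> is maximal in \<open>H\<close>, take \<open>n\<close> with
  \<open>L\<^sub>n \<inter> H \<not>\<subseteq> M\<close> and \<open>L\<^sub>n\<^sub>+\<^sub>1 \<inter> H \<subseteq> M\<close>: any \<open>y \<in> L\<^sub>n \<inter> H - M\<close> normalises \<open>M\<close> and \<open>y\<^sup>2 \<in> M\<close>, so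
  \<open>H = M \<union> M y\<close> and all squares of \<open>H\<close> lie in \<open>M\<close>. Modulo \<open>2\<^sup>j\<^sup>+\<^sup>1\<close> every element of the kernel of
  reduction modulo \<open>2\<^sup>j\<close>, \<open>j \<ge> 4\<close>, is the square of an element of the kernel modulo \<open>2\<^sup>j\<^sup>-\<^sup>1\<close>; descending
  induction on \<open>j\<close> puts the kernel modulo 16 into \<open>M\<close>.
\<close>

subsection \<open>Squares and maximal subgroups\<close>

text \<open>Since \<open>y\<close> can be moved to the right past \<open>M\<close>, a product of two
  elements of \<open>M y\<close> ends in \<open>y \<otimes> y\<close>, which \<open>M\<close>
  absorbs.\<close>

lemma (in group) subgroup_Un_r_coset:
  assumes M: "subgroup M G" and y: "y \<in> carrier G" and yy: "y \<otimes> y \<in> M"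
    and norm: "\<And>m. m \<in> M \<Longrightarrow> \<exists>m'\<in>M. y \<otimes> m = m' \<otimes> y"
  shows "subgroup (M \<union> (M #> y)) G"
proof (rule subgroupI)
  interpret M: subgroup M G by (rule M)
  note Mc = M.mem_carrier
  have coset: "m \<otimes> y \<in> M #> y" if "m \<in> M" for m
    using that by (auto simp: r_coset_def)
  show "M \<union> (M #> y) \<subseteq> carrier G"
    using y Mc by (auto simp: r_coset_def)
  show "M \<union> (M #> y) \<noteq> {}"
    using M.one_closed by blast
  fix a assume a: "a \<in> M \<union> (M #> y)"
  show "inv a \<in> M \<union> (M #> y)"
  proof (cases "a \<in> M")
    case False
    then obtain m where m: "m \<in> M" "a = m \<otimes> y"
      using a by (auto simp: r_coset_def)
    obtain m' where m': "m' \<in> M" "y \<otimes> inv m = m' \<otimes> y"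
      using norm m by blast
    have "inv a = inv y \<otimes> inv m"
      using m y Mc by (simp add: inv_mult_group)
    \<comment> \<open>\<open>norm\<close> moves \<open>y\<close> but not \<open>inv y\<close>, so
      \<open>inv y\<close> is traded for \<open>y\<close> times the inverse of the square.\<close>
    also have "\<dots> = inv (y \<otimes> y) \<otimes> (y \<otimes> inv m)"
    proof -
      have "inv (y \<otimes> y) \<otimes> (y \<otimes> inv m) = inv y \<otimes> (inv y \<otimes> (y \<otimes> inv m))"
        using m y Mc by (simp add: inv_mult_group m_assoc)
      also have "inv y \<otimes> (y \<otimes> inv m) = inv m"
        using m y Mc by (simp add: m_assoc[symmetric])
      finally show ?thesis by simp
    qed
    also have "\<dots> = (inv (y \<otimes> y) \<otimes> m') \<otimes> y"
      using m' y Mc by (simp add: m_assoc)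
    finally show ?thesis
      using coset yy m' by simp
  qed simp
  fix b assume b: "b \<in> M \<union> (M #> y)"
  show "a \<otimes> b \<in> M \<union> (M #> y)"
  proof (cases "a \<in> M")
    case True
    with b show ?thesis
      using coset y Mc by (auto simp: r_coset_def m_assoc[symmetric])
  next
    case False
    then obtain m where m: "m \<in> M" "a = m \<otimes> y"
      using a by (auto simp: r_coset_def)
    show ?thesis
    proof (cases "b \<in> M")
      case True
      obtain m' where m': "m' \<in> M" "y \<otimes> b = m' \<otimes> y"
        using norm True by blast
      have "a \<otimes> b = m \<otimes> (y \<otimes> b)"
        using m y True Mc by (simp add: m_assoc)
      also have "\<dots> = (m \<otimes> m') \<otimes> y"
        using m m' y Mc by (simp add: m_assoc)
      finally show ?thesis
        using coset m m' by simp
    next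
      case False
      then obtain n where n: "n \<in> M" "b = n \<otimes> y"
        using b by (auto simp: r_coset_def)
      obtain m' where m': "m' \<in> M" "y \<otimes> n = m' \<otimes> y"
        using norm n by blast
      have "a \<otimes> b = m \<otimes> (y \<otimes> n) \<otimes> y"
        using m n y Mc by (simp add: m_assoc)
      also have "\<dots> = m \<otimes> m' \<otimes> (y \<otimes> y)"
        using m m' y Mc by (simp add: m_assoc)
      finally show ?thesis
        using m m' yy by simp
    qed
  qed
qed

text \<open>The sets \<open>L n\<close> act as a central series of \<open>H\<close> with quotients
  of exponent 2; they make \<open>M\<close> normal of index 2 in \<open>H\<close>.\<close>

lemma (in group) square_mem_maximal_subgroup:
  assumes H: "subgroup H G" and max: "maximal_subgroup M (G\<lparr>carrier := H\<rparr>)"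
    and top: "H \<subseteq> L 0" and bot: "L r \<subseteq> {\<one>}"
    and comm: "\<And>n y h. y \<in> L n \<Longrightarrow> y \<in> H \<Longrightarrow> h \<in> H \<Longrightarrow> (y \<otimes> h) \<otimes> inv (h \<otimes> y) \<in> L (Suc n)"
    and square: "\<And>n y. y \<in> L n \<Longrightarrow> y \<in> H \<Longrightarrow> y \<otimes> y \<in> L (Suc n)"
    and x: "x \<in> H"
  shows "x \<otimes> x \<in> M"
proof -
  interpret H: subgroup H G by (rule H)
  have M: "subgroup M G" and MH: "M \<subseteq> H" "M \<noteq> H"
    using max incl_subgroup[OF H] subgroup.subset[of M "G\<lparr>carrier := H\<rparr>"]
    by (auto simp: maximal_subgroup_def)
  have maxD: "K = M \<or> K = H" if "subgroup K G" "M \<subseteq> K" "K \<subseteq> H" for K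
    using max subgroup_incl[OF that(1) H that(3)] that(2) by (auto simp: maximal_subgroup_def)
  interpret M: subgroup M G by (rule M)
  note Mc = M.mem_carrier and Hc = H.mem_carrier
  have "\<not> L 0 \<inter> H \<subseteq> M"
    using MH top by blast
  moreover have "L r \<inter> H \<subseteq> M"
    using bot M.one_closed by blast
  \<comment> \<open>This is where the chain first drops into \<open>M\<close>: commutators with
    \<open>y\<close> and the square of \<open>y\<close> then land in \<open>M\<close>.\<close>
  ultimately obtain n where n: "\<not> L n \<inter> H \<subseteq> M" "L (Suc n) \<inter> H \<subseteq> M"
    using ex_least_nat_less[of "\<lambda>n. L n \<inter> H \<subseteq> M" r] by blast
  then obtain y where y: "y \<in> L n" "y \<in> H" "y \<notin> M"
    by blast
  have yy: "y \<otimes> y \<in> M"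
    using n square y by blast
  have norm: "\<exists>m'\<in>M. y \<otimes> m = m' \<otimes> y" if m: "m \<in> M" for m
  proof
    have mH: "m \<in> H"
      using m MH by blast
    let ?c = "(y \<otimes> m) \<otimes> inv (m \<otimes> y)"
    have "?c \<in> M"
      using n comm[OF y(1,2) mH] y mH by blast
    then show "?c \<otimes> m \<in> M"
      using m by simp
    have "?c \<otimes> m \<otimes> y = ?c \<otimes> (m \<otimes> y)"
      using y mH Hc by (simp add: m_assoc)
    also have "\<dots> = y \<otimes> m \<otimes> (inv (m \<otimes> y) \<otimes> (m \<otimes> y))"
      using y mH Hc by (intro m_assoc) auto
    also have "\<dots> = y \<otimes> m"
      using y mH Hc by simp
    finally show "y \<otimes> m = ?c \<otimes> m \<otimes> y" ..
  qed
  have "subgroup (M \<union> (M #> y)) G"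
    using M yy norm y Hc by (intro subgroup_Un_r_coset) auto
  moreover have "M \<union> (M #> y) \<subseteq> H"
    using MH y by (auto simp: r_coset_def)
  moreover have "y \<in> M #> y"
    using rcos_self[OF _ M] y Hc by blast
  ultimately have H_eq: "H = M \<union> (M #> y)"
    using maxD[of "M \<union> (M #> y)"] y by blast
  show ?thesis
  proof (cases "x \<in> M")
    case False
    then obtain m where m: "m \<in> M" "x = m \<otimes> y"
      using x H_eq by (auto simp: r_coset_def)
    obtain m' where m': "m' \<in> M" "y \<otimes> m = m' \<otimes> y"
      using norm m by blast
    have "x \<otimes> x = m \<otimes> (y \<otimes> m) \<otimes> y"
      using m y Mc Hc by (simp add: m_assoc)
    also have "\<dots> = m \<otimes> m' \<otimes> (y \<otimes> y)"
      using m m' y Mc Hc by (simp add: m_assoc)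
    finally show ?thesis
      using m m' yy by simp
  qed simp
qed

subsection \<open>The Iwahori filtration\<close>

text \<open>
  The rows of level \<open>e = 0, 1, 2, \<dots>\<close> form the lattice chain
  \<open>R \<times> R \<supseteq> 2R \<times> R \<supseteq> 2R \<times> 2R \<supseteq> 4R \<times> 2R \<supseteq> \<dots>\<close> stabilised by the matrices with even lower left entry.
\<close>

definition row_level :: "nat \<Rightarrow> 'a::comm_ring_1^2 \<Rightarrow> bool" where
  "row_level e r \<longleftrightarrow> 2 ^ (Suc e div 2) dvd r $ 1 \<and> 2 ^ (e div 2) dvd r $ 2"

text \<open>At \<open>n = 0\<close> the vector and the upper right entry are free and the other
  three entries are even. Each row lies one level deeper than the row above it, which is what
  multiplication from the left requires.\<close>

definition array_level :: "nat \<Rightarrow> 'a::comm_ring_1 affine2 \<Rightarrow> bool" where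
  "array_level n = (\<lambda>(v, a). row_level n v \<and> row_level (n + 1) (a $ 1) \<and> row_level (n + 2) (a $ 2))"

definition affine_level :: "nat \<Rightarrow> 'a::comm_ring_1 affine2 set" where
  "affine_level n = {(v, g). array_level n (v, g - mat 1)}"

lemma row_level_add: "row_level e r \<Longrightarrow> row_level e s \<Longrightarrow> row_level e (r + s)"
  and row_level_diff: "row_level e r \<Longrightarrow> row_level e s \<Longrightarrow> row_level e (r - s)"
  by (auto simp: row_level_def)

lemma row_level_smult: "row_level e r \<Longrightarrow> row_level e (c *s r)"
  by (auto simp: row_level_def)

lemma row_level_even_smult:
  assumes "row_level e r" "2 dvd c" shows "row_level (e + 2) (c *s r)"
  using assms by (auto simp: row_level_def intro: mult_dvd_mono)

lemma row_level_Suc: "row_level (Suc e) r \<Longrightarrow> row_level e r"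
  by (auto simp: row_level_def div_le_mono simp del: power_Suc div2_Suc_Suc intro: power_le_dvd)

lemma vector_matrix_mult_2:
  "r v* h = r $ 1 *s h $ 1 + r $ 2 *s h $ 2" for h :: "'a::comm_ring_1^2^2"
  by (simp add: vec_eq_iff forall_2 vector_matrix_mult_def sum_2 mult.commute)

lemma row_matrix_mult: "(a ** b) $ i = a $ i v* b" for a b :: "'a::comm_ring_1^2^2"
  by (simp add: vec_eq_iff matrix_matrix_mult_def vector_matrix_mult_def mult.commute)

text \<open>The second coordinate may have one factor 2 fewer than the first; the even lower left
  entry supplies it.\<close>

lemma row_level_mult_right:
  assumes "row_level e r" "2 dvd h $ 2 $ 1" shows "row_level e (r v* h)"
proof -
  have r: "2 ^ (Suc e div 2) dvd r $ 1" "2 ^ (e div 2) dvd r $ 2"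
    using assms by (auto simp: row_level_def)
  have "2 ^ Suc (e div 2) dvd r $ 2 * h $ 2 $ 1"
    using mult_dvd_mono[OF r(2) assms(2)] by (simp add: mult.commute)
  then have 1: "2 ^ (Suc e div 2) dvd r $ 2 * h $ 2 $ 1"
    by (rule power_le_dvd) linarith
  have 2: "2 ^ (e div 2) dvd r $ 1"
    using r(1) by (rule power_le_dvd) (simp add: div_le_mono)
  show ?thesis
    using 1 2 r by (simp add: row_level_def vector_matrix_mult_2)
qed

text \<open>Only the upper right entry of \<open>b\<close> can be odd. It carries the first
  coordinate to the second, where level \<open>Suc e\<close> asks for no more than level
  \<open>e\<close> asks of the first.\<close>

lemma row_level_mult_array:
  assumes "row_level e r" "array_level 0 (w, b)" shows "row_level (Suc e) (r v* b)"
proof -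
  have b: "2 dvd b $ 1 $ 1" "2 dvd b $ 2 $ 1" "2 dvd b $ 2 $ 2"
    using assms by (auto simp: array_level_def row_level_def)
  have r: "2 ^ (Suc e div 2) dvd r $ 1" "2 ^ (e div 2) dvd r $ 2"
    using assms by (auto simp: row_level_def)
  have "2 ^ Suc (Suc e div 2) dvd r $ 1 * b $ 1 $ 1"
    using mult_dvd_mono[OF r(1) b(1)] by (simp add: mult.commute)
  then have 1: "2 ^ Suc (e div 2) dvd r $ 1 * b $ 1 $ 1"
    by (rule power_le_dvd) (simp add: div_le_mono)
  have 2: "2 ^ Suc (e div 2) dvd r $ 2 * b $ 2 $ 1"
    using mult_dvd_mono[OF r(2) b(2)] by (simp add: mult.commute)
  have "2 ^ Suc (e div 2) dvd r $ 2 * b $ 2 $ 2"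
    using mult_dvd_mono[OF r(2) b(3)] by (simp add: mult.commute)
  then have 3: "2 ^ (Suc e div 2) dvd r $ 2 * b $ 2 $ 2"
    by (rule power_le_dvd) linarith
  show ?thesis
    using 1 2 3 r by (auto simp: row_level_def vector_matrix_mult_2)
qed

lemma array_level_mult_right:
  assumes "array_level n (v, a)" "2 dvd h $ 2 $ 1" shows "array_level n (v v* h, a ** h)"
  using assms by (auto simp: array_level_def row_matrix_mult intro: row_level_mult_right)

lemma array_level_Suc_mult_right:
  assumes "array_level n (v, a)" "array_level 0 (w, b)"
  shows "array_level (Suc n) (v v* b, a ** b)"
  using assms row_level_mult_array[OF _ assms(2)]
  by (auto simp: array_level_def row_matrix_mult)

text \<open>New rows are combinations of rows of \<open>a\<close>. A coefficient that may be odd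
  multiplies a row that is deep enough already; every other coefficient is even and gains two
  levels.\<close>

lemma array_level_Suc_mult_left:
  assumes "array_level n (v, a)" "array_level 0 (w, b)"
  shows "array_level (Suc n) (w v* a, b ** a)"
proof -
  have b: "2 dvd b $ 1 $ 1" "2 dvd b $ 2 $ 1" "2 dvd b $ 2 $ 2"
    using assms by (auto simp: array_level_def row_level_def)
  have a: "row_level (Suc n) (a $ 1)" "row_level (Suc (Suc n)) (a $ 2)"
    using assms by (auto simp: array_level_def)
  have e: "row_level (Suc (Suc (Suc n))) (c *s a $ 1)"
    "row_level (Suc (Suc (Suc (Suc n)))) (c *s a $ 2)" if "2 dvd c" for c
    using row_level_even_smult[OF a(1) that] row_level_even_smult[OF a(2) that] by simp_all
  show ?thesis
    using a b e
    by (auto simp: array_level_def row_matrix_mult vector_matrix_mult_2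
        intro!: row_level_add intro: row_level_smult row_level_Suc)
qed

lemma array_level_diff:
  "array_level n (v, a) \<Longrightarrow> array_level n (w, b) \<Longrightarrow> array_level n (v - w, a - b)"
  by (auto simp: array_level_def row_level_diff)

lemma array_level_add:
  "array_level n (v, a) \<Longrightarrow> array_level n (w, b) \<Longrightarrow> array_level n (v + w, a + b)"
  by (auto simp: array_level_def row_level_add)

lemma array_level_double:
  assumes "array_level n (v, a)" shows "array_level (Suc n) (v + v, a + a)"
proof -
  have "row_level (Suc e) (r + r)" if "row_level e r" for e and r :: "'a^2"
  proof -
    have "r + r = 2 *s r"
      by (simp add: vec_eq_iff)
    then show ?thesis
      using row_level_even_smult[OF that, of 2] by (auto intro: row_level_Suc)
  qed
  then show ?thesis
    using assms by (auto simp: array_level_def)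
qed

section \<open>From arrays to the affine group\<close>

lemma AGL2_mult: "(v, g) \<otimes>\<^bsub>AGL2\<^esub> (w, h) = (w + v v* h, g ** h)"
  and AGL2_one: "\<one>\<^bsub>AGL2\<^esub> = (0, mat 1)"
  and AGL2_carrier: "(v, g) \<in> carrier AGL2 \<longleftrightarrow> invertible g"
  by (simp_all add: AGL2_def)

lemma matrix_add_left_distrib: "(a + b) ** c = a ** c + b ** c"
  for a b :: "'a::semiring_1^'n^'m"
  by (simp add: vec_eq_iff matrix_matrix_mult_def distrib_right sum.distrib)

lemma matrix_diff_left_distrib: "(a - b) ** c = a ** c - b ** c"
  for a b :: "'a::ring_1^'n^'m"
  by (simp add: vec_eq_iff matrix_matrix_mult_def left_diff_distrib sum_subtractf)

text \<open>Reduces a quotient of group elements to their componentwise difference, multiplied from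
  the right by the linear part of the inverse.\<close>

lemma AGL2_mult_inv:
  assumes "(v, g) \<in> carrier AGL2" "(w, h) \<in> carrier AGL2" "inv\<^bsub>AGL2\<^esub> (w, h) = (u, k)"
  shows "(v, g) \<otimes>\<^bsub>AGL2\<^esub> inv\<^bsub>AGL2\<^esub> (w, h) = ((v - w) v* k, mat 1 + (g - h) ** k)"
proof -
  interpret group "AGL2 :: 'a affine2 monoid" by (rule group_AGL2)
  have "(w, h) \<otimes>\<^bsub>AGL2\<^esub> (u, k) = (0, mat 1)"
    using r_inv[OF assms(2)] assms(3) by (simp add: AGL2_one)
  then have "u = - (w v* k)" "h ** k = mat 1"
    by (auto simp: AGL2_mult add_eq_0_iff2)
  then show ?thesis
    by (simp add: assms AGL2_mult vector_matrix_mult_diff_distrib matrix_diff_left_distrib)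
qed

lemma affine_level_mult_inv:
  assumes "(v, g) \<in> carrier AGL2" "(w, h) \<in> Gamma0_2_tilde" "array_level n (v - w, g - h)"
  shows "(v, g) \<otimes>\<^bsub>AGL2\<^esub> inv\<^bsub>AGL2\<^esub> (w, h) \<in> affine_level n"
proof -
  obtain u k where uk: "inv\<^bsub>AGL2\<^esub> (w, h) = (u, k)"
    by fastforce
  have "(u, k) \<in> Gamma0_2_tilde"
    using subgroup.m_inv_closed[OF subgroup_Gamma0_2_tilde assms(2)] uk by simp
  then have "2 dvd k $ 2 $ 1"
    by (simp add: Gamma0_2_tilde_def)
  then show ?thesis
    using AGL2_mult_inv[OF assms(1) _ uk] assms(2) array_level_mult_right[OF assms(3)]
    by (simp add: affine_level_def Gamma0_2_tilde_def)
qed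

lemma Gamma0_2_tilde_affine_level_0:
  assumes parity: "\<And>x::'a::comm_ring_1. 2 dvd x \<or> 2 dvd x - 1"
  shows "(Gamma0_2_tilde :: 'a affine2 set) \<subseteq> affine_level 0"
proof clarify
  fix v :: "'a^2" and g :: "'a^2^2"
  assume "(v, g) \<in> Gamma0_2_tilde"
  then have c: "2 dvd g $ 2 $ 1" and "invertible g"
    by (auto simp: Gamma0_2_tilde_def AGL2_def)
  then obtain h where h: "g ** h = mat 1" "h ** g = mat 1"
    by (auto simp: invertible_def)
  have "(h ** g) $ 1 $ 1 = 1" "(g ** h) $ 2 $ 2 = 1"
    by (simp_all add: h mat_def)
  then have e: "h$1$1 * g$1$1 + h$1$2 * g$2$1 = 1" "g$2$1 * h$1$2 + g$2$2 * h$2$2 = 1"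
    by (simp_all add: matrix_matrix_mult_def sum_2)
  \<comment> \<open>If a diagonal entry is even, then 2 divides everything and the claim still
    holds, so no contradiction is sought.\<close>
  have "2 dvd (1::'a)" if "2 dvd g $ 1 $ 1 \<or> 2 dvd g $ 2 $ 2"
    using that e c by (metis dvd_add dvd_mult dvd_mult2)
  then have "2 dvd g $ 1 $ 1 - 1" "2 dvd g $ 2 $ 2 - 1"
    using parity[of "g $ 1 $ 1"] parity[of "g $ 2 $ 2"] by (auto dest: dvd_diff)
  then show "(v, g) \<in> affine_level 0"
    using c by (simp add: affine_level_def array_level_def row_level_def mat_def)
qed

lemma affine_level_trivial:
  assumes "(2::'a::comm_ring_1) ^ k = 0"
  shows "(affine_level (2 * k) :: 'a affine2 set) \<subseteq> {\<one>\<^bsub>AGL2\<^esub>}"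
proof clarify
  fix v :: "'a^2" and g :: "'a^2^2"
  assume vg: "(v, g) \<in> affine_level (2 * k)"
  have row: "r = 0" if r: "row_level e r" and e: "2 * k \<le> e" for e and r :: "'a^2"
  proof -
    have "2 ^ k dvd r $ 1" "2 ^ k dvd r $ 2"
      using r e by (auto simp: row_level_def intro!: power_le_dvd[where m = k])
    then show ?thesis
      using assms by (simp add: vec_eq_iff forall_2)
  qed
  have "v = 0" "(g - mat 1) $ 1 = 0" "(g - mat 1) $ 2 = 0"
    using vg row[of "2 * k"] row[of "2 * k + 1"] row[of "2 * k + 2"]
    unfolding affine_level_def array_level_def by (simp_all del: vector_minus_component)
  moreover from this have "g - mat 1 = 0"
    unfolding vec_eq_iff[of "g - mat 1"] forall_2 by simp
  ultimately show "(v, g) = \<one>\<^bsub>AGL2\<^esub>"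
    by (simp add: AGL2_one)
qed

text \<open>In \<open>y h\<close> minus \<open>h y\<close> the linear terms cancel. What remains are
  products of one array of level \<open>n\<close> and one of level 0, and these have level
  \<open>Suc n\<close>.\<close>

lemma affine_level_commutator:
  assumes y: "y \<in> affine_level n" "y \<in> Gamma0_2_tilde"
    and h: "h \<in> affine_level 0" "h \<in> Gamma0_2_tilde"
  shows "(y \<otimes>\<^bsub>AGL2\<^esub> h) \<otimes>\<^bsub>AGL2\<^esub> inv\<^bsub>AGL2\<^esub> (h \<otimes>\<^bsub>AGL2\<^esub> y) \<in> affine_level (Suc n)"
proof -
  obtain v g w k where eq: "y = (v, g)" "h = (w, k)"
    by fastforce
  define a b where "a = g - mat 1" and "b = k - mat 1"
  have gk: "g = a + mat 1" "k = b + mat 1"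
    by (auto simp: a_def b_def)
  have lev: "array_level n (v, a)" "array_level 0 (w, b)"
    using y h by (auto simp: affine_level_def eq a_def b_def)
  have "array_level (Suc n) (v v* b - w v* a, a ** b - b ** a)"
    using lev by (intro array_level_diff array_level_Suc_mult_left array_level_Suc_mult_right)
  moreover have "v v* b - w v* a = (w + v v* k) - (v + w v* g)"
    by (simp add: a_def b_def vector_matrix_mult_diff_rdistrib)
  moreover have "a ** b - b ** a = g ** k - k ** g"
    by (simp add: gk matrix_add_ldistrib matrix_add_left_distrib)
  ultimately have "array_level (Suc n) ((w + v v* k) - (v + w v* g), g ** k - k ** g)"
    by simp
  moreover have "y \<otimes>\<^bsub>AGL2\<^esub> h \<in> Gamma0_2_tilde" "h \<otimes>\<^bsub>AGL2\<^esub> y \<in> Gamma0_2_tilde"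
    using y h by (simp_all only: subgroup.m_closed[OF subgroup_Gamma0_2_tilde])
  ultimately show ?thesis
    unfolding eq AGL2_mult by (intro affine_level_mult_inv) (simp_all add: Gamma0_2_tilde_def)
qed

text \<open>The array of \<open>y y\<close> is twice that of \<open>y\<close> plus its product with
  \<open>a\<close>. Doubling raises the level, and so does the product, because \<open>a\<close>
  also has level 0.\<close>

lemma affine_level_square:
  assumes y: "y \<in> affine_level n" "y \<in> affine_level 0"
  shows "y \<otimes>\<^bsub>AGL2\<^esub> y \<in> affine_level (Suc n)"
proof -
  obtain v g where eq: "y = (v, g)"
    by fastforce
  define a where "a = g - mat 1"
  have g: "g = a + mat 1"
    by (auto simp: a_def)
  have lev: "array_level n (v, a)" "array_level 0 (v, a)"
    using y by (auto simp: affine_level_def eq a_def)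
  have "array_level (Suc n) (v + v + v v* a, a + a + a ** a)"
    using lev by (intro array_level_add array_level_double array_level_Suc_mult_right)
  moreover have "v + v + v v* a = v + v v* g"
    by (simp add: a_def vector_matrix_mult_diff_rdistrib)
  moreover have "a + a + a ** a = g ** g - mat 1"
    by (simp add: g matrix_add_ldistrib matrix_add_left_distrib)
  ultimately show ?thesis
    by (simp only: eq AGL2_mult affine_level_def mem_Collect_eq case_prod_conv)
qed

lemma square_mem_maximal_subgroup_AGL2:
  fixes H :: "'a::comm_ring_1 affine2 set"
  assumes nil: "(2::'a) ^ k = 0" and parity: "\<And>x::'a. 2 dvd x \<or> 2 dvd x - 1"
    and H: "subgroup H AGL2" "H \<subseteq> Gamma0_2_tilde"
    and max: "maximal_subgroup M (AGL2\<lparr>carrier := H\<rparr>)" and x: "x \<in> H"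
  shows "x \<otimes>\<^bsub>AGL2\<^esub> x \<in> M"
proof -
  have H0: "H \<subseteq> affine_level 0"
    using Gamma0_2_tilde_affine_level_0[OF parity] H(2) by blast
  show ?thesis
    using affine_level_commutator affine_level_square H0 H(2)
    by (intro group.square_mem_maximal_subgroup[OF group_AGL2 H(1) max, where L = affine_level
          and r = "2 * k"] affine_level_trivial[OF nil] x) blast+
qed

subsection \<open>Congruence kernels\<close>

lemma invertible_of_square:
  assumes "invertible (g ** g)" shows "invertible g"
proof -
  obtain h where "g ** g ** h = mat 1" "h ** (g ** g) = mat 1"
    using assms by (auto simp: invertible_def)
  then have l: "g ** (g ** h) = mat 1" and r: "(h ** g) ** g = mat 1"
    by (simp_all add: matrix_mul_assoc)
  have "h ** g = (h ** g) ** (g ** (g ** h))"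
    by (simp add: l)
  also have "\<dots> = g ** h"
    by (simp add: matrix_mul_assoc r)
  finally show ?thesis
    using l r by (auto simp: invertible_def)
qed

lemma mem_congruence_kernel_2_power:
  "(v, g) \<in> congruence_kernel (2 ^ j) \<longleftrightarrow>
    invertible g \<and> (\<forall>i. 2 ^ j dvd v $ i) \<and> (\<forall>i l. 2 ^ j dvd (g - mat 1) $ i $ l)"
  by (simp add: congruence_kernel_def AGL2_carrier)

text \<open>Squaring improves the congruence from \<open>2 ^ j\<close> to \<open>2 ^ Suc j\<close>,
  and invertibility passes back from the square; the induction ends where \<open>2 ^ k = 0\<close>
  forces \<open>g = mat 1\<close>.\<close>

lemma invertible_of_congruent_mat_1:
  fixes g :: "'a::comm_ring_1^2^2"
  assumes nil: "(2::'a) ^ k = 0" and j: "1 \<le> j" and g: "\<And>i l. 2 ^ j dvd (g - mat 1) $ i $ l"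
  shows "invertible g"
  using j g
proof (induction "k - j" arbitrary: j g)
  case 0
  have "(g - mat 1) $ i $ l = 0" for i l
    using power_le_dvd[OF 0(3), of k i l] 0(1) nil by simp
  then have "g - mat 1 = 0"
    by (simp add: vec_eq_iff)
  then show ?case
    by (simp add: invertible_mat_1)
next
  case (Suc n)
  define a where "a = g - mat 1"
  have g: "g = a + mat 1"
    by (simp add: a_def)
  have a: "2 ^ j dvd a $ i $ l" for i l
    using Suc.prems by (simp add: a_def)
  have "g ** g - mat 1 = a + a + a ** a"
    by (simp add: g matrix_add_ldistrib matrix_add_left_distrib)
  moreover have "2 ^ Suc j dvd (a + a + a ** a) $ i $ l" for i l
  proof -
    have "2 ^ Suc j dvd a $ i $ l + a $ i $ l"
      using mult_dvd_mono[OF dvd_refl[of 2] a[of i l]] by simp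
    moreover have "2 ^ Suc j dvd a $ i $ m * a $ m $ l" for m
      using mult_dvd_mono[OF a[of i m] a[of m l]] Suc.prems(1)
      by (auto simp: power_add[symmetric] simp del: power_Suc intro: power_le_dvd)
    ultimately show ?thesis
      by (simp add: matrix_matrix_mult_def sum_2 del: power_Suc)
  qed
  ultimately have "invertible (g ** g)"
    using Suc.hyps(2) by (intro Suc.hyps(1)[of "Suc j"]) auto
  then show ?case
    by (rule invertible_of_square)
qed

lemma congruence_kernel_mult_inv:
  assumes "(v, g) \<in> carrier AGL2" "(w, h) \<in> carrier AGL2"
    and "\<And>i. 2 ^ j dvd (v - w) $ i" "\<And>i l. 2 ^ j dvd (g - h) $ i $ l"
  shows "(v, g) \<otimes>\<^bsub>AGL2\<^esub> inv\<^bsub>AGL2\<^esub> (w, h) \<in> congruence_kernel (2 ^ j)"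
proof -
  interpret group "AGL2 :: 'a affine2 monoid" by (rule group_AGL2)
  obtain u k where uk: "inv\<^bsub>AGL2\<^esub> (w, h) = (u, k)"
    by fastforce
  have "(v, g) \<otimes>\<^bsub>AGL2\<^esub> inv\<^bsub>AGL2\<^esub> (w, h) \<in> carrier AGL2"
    using assms by blast
  moreover have "2 ^ j dvd ((v - w) v* k) $ i" for i
    using assms(3) by (auto simp: vector_matrix_mult_def intro!: dvd_sum dvd_mult2)
  moreover have "2 ^ j dvd ((g - h) ** k) $ i $ l" for i l
    using assms(4) unfolding matrix_matrix_mult_def by (auto intro!: dvd_sum dvd_mult2)
  ultimately show ?thesis
    unfolding AGL2_mult_inv[OF assms(1,2) uk]
    by (simp add: mem_congruence_kernel_2_power AGL2_carrier)
qed

text \<open>Halving \<open>v\<close> and \<open>g - mat 1\<close> gives \<open>y\<close>. Its square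
  misses \<open>x\<close> only by terms quadratic in the halves.\<close>

lemma congruence_kernel_square_root_mod:
  fixes x :: "'a::comm_ring_1 affine2"
  assumes nil: "(2::'a) ^ k = 0" and j: "3 \<le> j" and x: "x \<in> congruence_kernel (2 ^ j)"
  obtains y where "y \<in> congruence_kernel (2 ^ (j - 1))"
    and "x \<otimes>\<^bsub>AGL2\<^esub> inv\<^bsub>AGL2\<^esub> (y \<otimes>\<^bsub>AGL2\<^esub> y) \<in> congruence_kernel (2 ^ Suc j)"
proof -
  interpret group "AGL2 :: 'a affine2 monoid" by (rule group_AGL2)
  obtain v g where xeq: "x = (v, g)"
    by fastforce
  \<comment> \<open>Halves need not be unique, so one that keeps the remaining powers of 2 is
    chosen.\<close>
  have half: "\<exists>s. r = 2 * s \<and> 2 ^ (j - 1) dvd s" if r: "2 ^ j dvd r" for r :: 'a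
  proof -
    obtain t where "r = 2 ^ j * t"
      using r by (rule dvdE)
    then have "r = 2 * (2 ^ (j - 1) * t)"
      using j by (cases j) (simp_all add: mult.assoc)
    then show ?thesis
      by (intro exI[of _ "2 ^ (j - 1) * t"]) simp
  qed
  have vg: "\<And>i. 2 ^ j dvd v $ i" "\<And>i l. 2 ^ j dvd (g - mat 1) $ i $ l"
    using x by (simp_all add: xeq mem_congruence_kernel_2_power)
  obtain w' where w': "\<And>i. v $ i = 2 * w' i \<and> 2 ^ (j - 1) dvd w' i"
    using half[OF vg(1)] by metis
  obtain b' where b': "\<And>i l. (g - mat 1) $ i $ l = 2 * b' i l \<and> 2 ^ (j - 1) dvd b' i l"
    using half[OF vg(2)] by metis
  define w b where "w = (\<chi> i. w' i)" and "b = (\<chi> i l. b' i l)"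
  have w: "v = w + w" "\<And>i. 2 ^ (j - 1) dvd w $ i"
    using w' by (simp_all add: w_def vec_eq_iff)
  have "g - mat 1 = b + b" and b: "\<And>i l. 2 ^ (j - 1) dvd b $ i $ l"
    using b' by (simp_all add: b_def vec_eq_iff)
  then have g: "g = mat 1 + b + b"
    by (simp add: algebra_simps)
  define y where "y = (w, mat 1 + b)"
  have y: "y \<in> congruence_kernel (2 ^ (j - 1))"
    using w(2) b j invertible_of_congruent_mat_1[OF nil, of "j - 1" "mat 1 + b"]
    by (simp add: y_def mem_congruence_kernel_2_power)
  have yy: "y \<otimes>\<^bsub>AGL2\<^esub> y = (w + w + w v* b, mat 1 + b + b + b ** b)"
    by (simp add: y_def AGL2_mult matrix_add_ldistrib matrix_add_left_distrib
        vector_matrix_mult_add_rdistrib)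
  \<comment> \<open>Here \<open>3 \<le> j\<close> enters, as
    \<open>2 * (j - 1) \<ge> j + 1\<close>.\<close>
  have prod: "2 ^ Suc j dvd s * t" if "2 ^ (j - 1) dvd s" "2 ^ (j - 1) dvd t" for s t :: 'a
    using mult_dvd_mono[OF that] j
    by (auto simp: power_add[symmetric] simp del: power_Suc intro: power_le_dvd)
  have "x \<otimes>\<^bsub>AGL2\<^esub> inv\<^bsub>AGL2\<^esub> (y \<otimes>\<^bsub>AGL2\<^esub> y) \<in> congruence_kernel (2 ^ Suc j)"
    unfolding xeq yy
  proof (rule congruence_kernel_mult_inv)
    show "(v, g) \<in> carrier AGL2"
      using x by (simp add: xeq mem_congruence_kernel_2_power AGL2_carrier)
    have "y \<in> carrier AGL2"
      using y by (auto simp: congruence_kernel_def)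
    then show "(w + w + w v* b, mat 1 + b + b + b ** b) \<in> carrier AGL2"
      unfolding yy[symmetric] by blast
    show "2 ^ Suc j dvd (v - (w + w + w v* b)) $ i" for i
      using w(2) b by (auto simp: w(1) vector_matrix_mult_def simp del: power_Suc
          intro!: dvd_sum prod)
    show "2 ^ Suc j dvd (g - (mat 1 + b + b + b ** b)) $ i $ l" for i l
      using b by (auto simp: g matrix_matrix_mult_def simp del: power_Suc intro!: dvd_sum prod)
  qed
  with y show thesis
    by (rule that)
qed

text \<open>Serves both for the maximal subgroups and for \<open>H\<close> itself. An element is a
  square times an error one level deeper, which the induction handles.\<close>

lemma congruence_kernel_subset_of_squares:
  fixes M :: "'a::comm_ring_1 affine2 set"
  assumes nil: "(2::'a) ^ k = 0" and M: "subgroup M AGL2"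
    and squares: "\<And>y. y \<in> congruence_kernel 8 \<Longrightarrow> y \<otimes>\<^bsub>AGL2\<^esub> y \<in> M"
    and j: "4 \<le> j"
  shows "congruence_kernel (2 ^ j) \<subseteq> M"
  using j
proof (induction "k - j" arbitrary: j)
  case 0
  have "x = \<one>\<^bsub>AGL2\<^esub>" if "x \<in> congruence_kernel (2 ^ j)" for x :: "'a affine2"
  proof -
    obtain v g where x: "x = (v, g)"
      by fastforce
    have "(2::'a) ^ j = 0"
      using 0(1) le_imp_power_dvd[of k j "2::'a"] nil by simp
    then show ?thesis
      using that by (simp add: x mem_congruence_kernel_2_power AGL2_one vec_eq_iff)
  qed
  then show ?case
    using subgroup.one_closed[OF M] by blast
next
  case (Suc n)
  interpret group "AGL2 :: 'a affine2 monoid" by (rule group_AGL2)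
  interpret M: subgroup M AGL2 by (rule M)
  show ?case
  proof
    fix x :: "'a affine2" assume x: "x \<in> congruence_kernel (2 ^ j)"
    have "3 \<le> j"
      using Suc.prems by simp
    then obtain y where y: "y \<in> congruence_kernel (2 ^ (j - 1))"
      and xy: "x \<otimes>\<^bsub>AGL2\<^esub> inv\<^bsub>AGL2\<^esub> (y \<otimes>\<^bsub>AGL2\<^esub> y) \<in> congruence_kernel (2 ^ Suc j)"
      using congruence_kernel_square_root_mod[OF nil _ x] by blast
    obtain w h where "y = (w, h)"
      by fastforce
    \<comment> \<open>\<open>4 \<le> j\<close> gives \<open>j - 1 \<ge> 3\<close>: the root stays in
      the kernel modulo 8, where squares are known to lie in \<open>M\<close>.\<close>
    then have "y \<in> congruence_kernel (2 ^ 3)"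
      using y Suc.prems by (auto simp only: mem_congruence_kernel_2_power intro!: power_le_dvd[where n = "j - 1" and m = 3])
    then have yy: "y \<otimes>\<^bsub>AGL2\<^esub> y \<in> M"
      by (intro squares) simp
    have "x \<otimes>\<^bsub>AGL2\<^esub> inv\<^bsub>AGL2\<^esub> (y \<otimes>\<^bsub>AGL2\<^esub> y) \<in> M"
      using Suc.hyps(1)[of "Suc j"] Suc.hyps(2) Suc.prems xy by fastforce
    then have "x \<otimes>\<^bsub>AGL2\<^esub> inv\<^bsub>AGL2\<^esub> (y \<otimes>\<^bsub>AGL2\<^esub> y) \<otimes>\<^bsub>AGL2\<^esub> (y \<otimes>\<^bsub>AGL2\<^esub> y) \<in> M"
      using yy by (rule M.m_closed)
    moreover have "x \<in> carrier AGL2" "y \<otimes>\<^bsub>AGL2\<^esub> y \<in> carrier AGL2"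
      using x M.mem_carrier[OF yy] by (auto simp: congruence_kernel_def)
    ultimately show "x \<in> M"
      by (simp add: m_assoc del: M.m_closed)
  qed
qed

section \<open>Specialisation to residue rings\<close>

lemma mod_ring_even_or_odd: "2 dvd x \<or> 2 dvd x - 1" for x :: "'q::nontriv mod_ring"
proof -
  obtain z where z: "x = of_int z"
    by (metis of_int_of_int_mod_ring of_int_mod_ring_to_int_mod_ring)
  obtain m where "z = 2 * m \<or> z = 2 * m + 1"
    by (metis evenE oddE)
  then have "x = 2 * of_int m \<or> x - 1 = 2 * of_int m"
    by (auto simp: z)
  then show ?thesis
    by auto
qed

theorem theorem3p3:
  fixes k :: nat
    and H :: "('q::nontriv) mod_ring affine2 set"
  assumes "k \<ge> 3"
    and "CARD('q) = 2 ^ k"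
    and "subgroup H AGL2"
    and "H \<subseteq> Gamma0_2_tilde"
    and "congruence_kernel 8 \<subseteq> H"
  shows "congruence_kernel 16 \<subseteq> frattini (AGL2\<lparr>carrier := H\<rparr>)"
proof -
  have "of_nat (CARD('q)) = (0 :: 'q mod_ring)"
    by (transfer) simp
  then have nil: "(2 :: 'q mod_ring) ^ k = 0"
    by (simp add: assms(2))
  note kernel_subset = congruence_kernel_subset_of_squares[OF nil, of _ 4, simplified]
  \<comment> \<open>The definition of \<open>frattini\<close> also intersects with the carrier.
    Squares of elements of the kernel modulo 8 lie in \<open>H\<close> by closure.\<close>
  have "congruence_kernel 16 \<subseteq> H"
    using assms(3,5) by (intro kernel_subset subgroup.m_closed) auto
  moreover have "congruence_kernel 16 \<subseteq> M" if M: "maximal_subgroup M (AGL2\<lparr>carrier := H\<rparr>)" for M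
  proof (rule kernel_subset)
    show "subgroup M AGL2"
      using M group.incl_subgroup[OF group_AGL2 assms(3)] by (simp add: maximal_subgroup_def)
    show "y \<otimes>\<^bsub>AGL2\<^esub> y \<in> M" if "y \<in> congruence_kernel 8" for y
      using that assms(5)
      by (intro square_mem_maximal_subgroup_AGL2[OF nil mod_ring_even_or_odd assms(3,4) M]) blast
  qed
  ultimately show ?thesis
    by (auto simp: frattini_def)
qed

end
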